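(* Let $d=n+m$ and let $\Theta$ be a good real $m\times n$ matrix such that the $n$-dimensional subspace $\mathcal{L}=\{(x,y)\in\mathbb{R}^n\times\mathbb{R}^m: y=\Theta x\}\subset\mathbb{R}^d$ is completely irrational. Then $R(\Theta)\ge d-n+1$.
   Context: A linear subspace of $\mathbb{R}^d$ is rational if it has a basis of integer vectors; an $n$-dimensional subspace $\mathcal{L}\subset\mathbb{R}^d$, $n<d$, is completely irrational if $\mathcal{L}\cap\mathcal{M}=\{0\}$ for every rational subspace $\mathcal{M}$ of dimension $d-n$. Best approximations: for an integer vector $z=(x,y)\in\mathbb{Z}^n\times\mathbb{Z}^m$ with $x\neq0$ put $|x|=\max_i|x_i|$ and $\zeta(z)=\max_j|L_j(x)-y_j|$, where $L_j(x)=\sum_i\theta_j^ix_i$. An integer vector $z$ is a best approximation vector for $\Theta$ if $\zeta(z)<\zeta(z')$ for every integer $z'=(x',y')$, $z'\neq \pm z$, with $0<|x'|\le|x|$ (and, whenever $|x'|<|x|$, also $\zeta(z')>\zeta(z)$). $\Theta$ is called good if its best approximation vectors are uniquely determined (up to sign), so that they form a well-defined sequence $z_1,z_2,\dots$ ordered by increasing $|x_\nu|$ (with decreasing $\zeta(z_\nu)$); these are the best approximation vectors for $\mathcal{L}$. For good $\Theta$, $R(\Theta)$ is the minimal $r$ such that there exist a linear subspace $\mathcal{B}\subseteq\mathbb{R}^d$ with $\dim\mathcal{B}=r$ and $\nu_0\in\mathbb{N}$ with $z_\nu\in\mathcal{B}$ for all $\nu\ge\nu_0$. *)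

theory Defs
  imports "HOL-Analysis.Analysis"
begin

definition integer_vector :: "'a::euclidean_space \<Rightarrow> bool" where
  "integer_vector z \<longleftrightarrow> (\<forall>b\<in>Basis. z \<bullet> b \<in> \<int>)"

definition rational_subspace :: "'a::euclidean_space set \<Rightarrow> bool" where
  "rational_subspace M \<longleftrightarrow>
     (\<exists>B. independent B \<and> span B = M \<and> (\<forall>b\<in>B. integer_vector b))"

definition completely_irrational :: "'a::euclidean_space set \<Rightarrow> bool" where
  "completely_irrational L \<longleftrightarrow>
     subspace L \<and> dim L < DIM('a) \<and>
     (\<forall>M. rational_subspace M \<and> dim M = DIM('a) - dim L \<longrightarrow> L \<inter> M = {0})"

definition graph_subspace :: "real^'n^'m \<Rightarrow> ((real^'n) \<times> (real^'m)) set" where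
  "graph_subspace \<Theta> = {(x, y). y = \<Theta> *v x}"

text \<open>On \<open>real^'k\<close>, \<^const>\<open>infnorm\<close> is the maximum of the absolute values of the coordinates.\<close>

definition height :: "(real^'n) \<times> (real^'m) \<Rightarrow> real" where
  "height z = infnorm (fst z)"

definition zeta :: "real^'n^'m \<Rightarrow> (real^'n) \<times> (real^'m) \<Rightarrow> real" where
  "zeta \<Theta> z = infnorm (\<Theta> *v fst z - snd z)"

definition best_approx :: "real^'n^'m \<Rightarrow> (real^'n) \<times> (real^'m) \<Rightarrow> bool" where
  "best_approx \<Theta> z \<longleftrightarrow>
     integer_vector z \<and> fst z \<noteq> 0 \<and>
     (\<forall>z'. integer_vector z' \<and> z' \<noteq> z \<and> z' \<noteq> - z \<and> 0 < height z' \<and> height z' \<le> height z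
        \<longrightarrow> zeta \<Theta> z < zeta \<Theta> z')"

text \<open>
  A vector satisfying \<open>best_approx\<close> is by definition the only one of its height, up to sign.
  Uniqueness of best approximations is therefore a condition on the following weaker notion,
  in which ties between vectors of the same height are permitted: the height of such a vector
  is one at which the minimum of \<open>zeta\<close> over all smaller heights is improved, and the
  vector attains the new minimum.
\<close>

definition best_approx_with_ties :: "real^'n^'m \<Rightarrow> (real^'n) \<times> (real^'m) \<Rightarrow> bool" where
  "best_approx_with_ties \<Theta> z \<longleftrightarrow>
     integer_vector z \<and> fst z \<noteq> 0 \<and>
     (\<forall>z'. integer_vector z' \<and> 0 < height z' \<and> height z' \<le> height z
        \<longrightarrow> zeta \<Theta> z \<le> zeta \<Theta> z') \<and>
     (\<forall>z'. integer_vector z' \<and> 0 < height z' \<and> height z' < height z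
        \<longrightarrow> zeta \<Theta> z < zeta \<Theta> z')"

definition good :: "real^'n^'m \<Rightarrow> bool" where
  "good \<Theta> \<longleftrightarrow>
     (\<forall>z z'. best_approx_with_ties \<Theta> z \<and> best_approx_with_ties \<Theta> z' \<and> height z = height z'
        \<longrightarrow> z' = z \<or> z' = - z)"

text \<open>
  The set \<open>{z\<^sub>\<nu>, - z\<^sub>\<nu>}\<close>, where \<open>z\<^sub>1, z\<^sub>2, \<dots>\<close> are the best approximations in order of increasing
  height. It is empty for \<open>\<nu> = 0\<close> and beyond the end of a terminating sequence.
\<close>

definition nth_best_approx :: "real^'n^'m \<Rightarrow> nat \<Rightarrow> ((real^'n) \<times> (real^'m)) set" where
  "nth_best_approx \<Theta> \<nu> =
     {z. best_approx \<Theta> z \<and>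
         card (height ` {z'. best_approx \<Theta> z' \<and> height z' \<le> height z}) = \<nu>}"

definition R :: "real^'n^'m \<Rightarrow> nat" where
  "R \<Theta> =
     (LEAST r. \<exists>B :: ((real^'n) \<times> (real^'m)) set. \<exists>\<nu>\<^sub>0.
        subspace B \<and> dim B = r \<and> (\<forall>\<nu>\<ge>\<nu>\<^sub>0. nth_best_approx \<Theta> \<nu> \<subseteq> B))"

end

theory Submission imports Defs begin

text \<open>
  Suppose that from some point on all best approximations lie in a subspace of dimension at most
  \<open>m = d - n\<close>. Being integer vectors, they then lie in a rational subspace \<open>M\<close> of dimension
  exactly \<open>m\<close>, and \<open>M\<close> meets the graph of \<open>\<Theta>\<close> only in \<open>0\<close>. Hence \<open>zeta\<close> is a norm on \<open>M\<close>, so it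
  dominates a positive multiple of the height there. But \<open>zeta\<close> is bounded on best approximations,
  while Dirichlet's theorem provides best approximations of arbitrarily large height.
\<close>

section \<open>Integer vectors and rational subspaces\<close>

lemma integer_vector_Pair_iff:
  "integer_vector (x, y) \<longleftrightarrow> integer_vector x \<and> integer_vector y"
  by (auto simp: integer_vector_def Basis_prod_def ball_Un)

lemma integer_vector_Basis: "b \<in> Basis \<Longrightarrow> integer_vector b"
  by (auto simp: integer_vector_def inner_Basis)

text \<open>The coordinates are integers bounded by the norm, so only finitely many coordinate
  functions on \<open>Basis\<close> occur, and these determine the vector.\<close>

lemma finite_integer_vectors_bounded:
  fixes S :: "'a::euclidean_space set"
  assumes "bounded S"
  shows "finite {z \<in> S. integer_vector z}"
proof -
  obtain r where r: "\<And>z. z \<in> S \<Longrightarrow> norm z \<le> r"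
    using assms by (auto simp: bounded_iff)
  let ?P = "Basis \<rightarrow>\<^sub>E {k \<in> \<int>. \<bar>k\<bar> \<le> r}"
  have "z \<in> (\<lambda>f. \<Sum>b\<in>Basis. f b *\<^sub>R b) ` ?P" if "z \<in> S" "integer_vector z" for z
  proof (rule image_eqI)
    show "z = (\<Sum>b\<in>Basis. restrict (\<lambda>b. z \<bullet> b) Basis b *\<^sub>R b)"
      by (simp add: euclidean_representation)
    show "restrict (\<lambda>b. z \<bullet> b) Basis \<in> ?P"
      using that r by (auto simp: integer_vector_def intro: order_trans[OF Basis_le_norm])
  qed
  then have "{z \<in> S. integer_vector z} \<subseteq> (\<lambda>f. \<Sum>b\<in>Basis. f b *\<^sub>R b) ` ?P"
    by blast
  then show ?thesis
    by (rule finite_subset) (intro finite_imageI finite_PiE finite_Basis finite_abs_int_segment)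
qed

lemma infnorm_integer_vector_ge_1:
  fixes x :: "'a::euclidean_space"
  assumes "integer_vector x" "x \<noteq> 0"
  shows "1 \<le> infnorm x"
proof -
  obtain b where b: "b \<in> Basis" "x \<bullet> b \<noteq> 0"
    using assms(2) by (auto simp: euclidean_eq_iff[of x 0])
  then have "1 \<le> \<bar>x \<bullet> b\<bar>"
    using assms(1) by (intro Ints_nonzero_abs_ge1) (auto simp: integer_vector_def)
  also have "\<dots> \<le> infnorm x"
    using b by (intro Basis_le_infnorm)
  finally show ?thesis .
qed

text \<open>A basis chosen inside \<open>W\<close> is completed to a basis of the whole space by
  standard basis vectors, so all its members are integer vectors. Any \<open>k\<close> of them that
  include the basis of \<open>W\<close> span a suitable \<open>M\<close>. The dimension is made
  exact because complete irrationality speaks of one dimension only.\<close>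

lemma rational_subspace_extend:
  fixes W :: "'a::euclidean_space set"
  assumes int: "\<And>w. w \<in> W \<Longrightarrow> integer_vector w" and "dim W \<le> k" "k \<le> DIM('a)"
  obtains M where "rational_subspace M" "dim M = k" "W \<subseteq> M"
proof -
  obtain C where C: "C \<subseteq> W" "independent C" "W \<subseteq> span C" "card C = dim W"
    by (rule basis_exists)
  obtain D where D: "C \<subseteq> D" "D \<subseteq> C \<union> Basis" "independent D" "C \<union> Basis \<subseteq> span D"
    using C(2) by (rule maximal_independent_subset_extend[of C "C \<union> Basis", rotated]) auto
  have "span D = UNIV"
    using D(4) span_minimal[of Basis "span D"] by auto
  then have "card D = DIM('a)"
    using dim_eq_card_independent[OF D(3)] dim_span[of D] by simp
  moreover have "finite D"
    using D(3) by (simp add: independent_imp_finite)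
  ultimately obtain E where E: "C \<subseteq> E" "E \<subseteq> D" "card E = k"
    using exists_subset_between[of C k D] C assms D(1) by auto
  have "independent E"
    using D(3) E(2) by (rule independent_mono)
  show thesis
  proof
    show "rational_subspace (span E)"
      unfolding rational_subspace_def
      using \<open>independent E\<close> E(2) D(2) C(1) int integer_vector_Basis by blast
    show "dim (span E) = k"
      using \<open>independent E\<close> E(3) by (simp add: dim_eq_card_independent)
    show "W \<subseteq> span E"
      using C(3) E(1) span_mono by blast
  qed
qed

section \<open>The graph of \<open>\<Theta>\<close> and the zeros of \<open>zeta\<close>\<close>

lemma graph_subspace_eq_range: "graph_subspace \<Theta> = range (\<lambda>x. (x, \<Theta> *v x))"
  by (auto simp: graph_subspace_def)

lemma dim_graph_subspace:
  fixes \<Theta> :: "real^'n^'m"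
  shows "dim (graph_subspace \<Theta>) = CARD('n)"
proof -
  have "linear (\<lambda>x. (x, \<Theta> *v x))"
    by (intro linearI) (auto simp: matrix_vector_right_distrib matrix_vector_mult_scaleR)
  then have "dim (range (\<lambda>x. (x, \<Theta> *v x))) = dim (UNIV :: (real^'n) set)"
    by (rule dim_image_eq) (auto simp: inj_on_def)
  then show ?thesis
    by (simp add: graph_subspace_eq_range)
qed

lemma completely_irrational_graph_Int:
  fixes \<Theta> :: "real^'n^'m"
  assumes "completely_irrational (graph_subspace \<Theta>)"
    and "rational_subspace M" "dim M = CARD('m)"
  shows "graph_subspace \<Theta> \<inter> M = {0}"
  using assms by (simp add: completely_irrational_def dim_graph_subspace)

lemma zeta_eq_0_iff: "zeta \<Theta> z = 0 \<longleftrightarrow> z \<in> graph_subspace \<Theta>"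
  by (auto simp: zeta_def graph_subspace_def infnorm_eq_0 case_prod_beta)

lemma zeta_uminus: "zeta \<Theta> (- z) = zeta \<Theta> z"
proof -
  have "\<Theta> *v fst (- z) - snd (- z) = - (\<Theta> *v fst z - snd z)"
    using matrix_vector_mult_scaleR[of \<Theta> "- 1" "fst z"] by simp
  then show ?thesis
    by (simp only: zeta_def infnorm_neg)
qed

text \<open>As \<open>CARD('m)\<close> is at least 1, \<open>z\<close> lies in a rational subspace
  of dimension \<open>CARD('m)\<close>, which meets the graph only in 0.\<close>

lemma zeta_pos_of_integer_vector:
  fixes \<Theta> :: "real^'n^'m"
  assumes "completely_irrational (graph_subspace \<Theta>)" "integer_vector z" "z \<noteq> 0"
  shows "0 < zeta \<Theta> z"
proof -
  have "dim {z} \<le> CARD('m)"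
    using dim_le_card[of "{z}" "{z}"] by (auto simp: span_base Suc_le_eq intro: order_trans)
  then obtain M where M: "rational_subspace M" "dim M = CARD('m)" "{z} \<subseteq> M"
    using rational_subspace_extend[of "{z}" "CARD('m)"] assms(2) by auto
  then have "z \<notin> graph_subspace \<Theta>"
    using completely_irrational_graph_Int[OF assms(1)] assms(3) by blast
  then show ?thesis
    using zeta_eq_0_iff[of \<Theta> z] infnorm_pos_le[of "\<Theta> *v fst z - snd z"]
    by (simp add: zeta_def)
qed

text \<open>The linear map \<open>g\<close> is an involution that exchanges \<open>y\<close> with
  the error \<Theta> x - y. Hence the vectors in question lie in the image under \<open>g\<close> of
  a product of two balls, which is bounded; the square roots pass from the maximum norm to the
  Euclidean norm.\<close>

lemma finite_integer_vectors_height_zeta: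
  fixes \<Theta> :: "real^'n^'m"
  shows "finite {z. integer_vector z \<and> height z \<le> h \<and> zeta \<Theta> z \<le> k}"
proof -
  define g :: "(real^'n) \<times> (real^'m) \<Rightarrow> (real^'n) \<times> (real^'m)"
    where "g = (\<lambda>(x, w). (x, \<Theta> *v x - w))"
  let ?S = "g ` (cball 0 (sqrt DIM(real^'n) * h) \<times> cball 0 (sqrt DIM(real^'m) * k))"
  have "linear g"
    by (intro linearI) (auto simp: g_def matrix_vector_right_distrib matrix_vector_mult_scaleR
        scaleR_diff_right)
  then have "bounded ?S"
    by (intro bounded_linear_image bounded_Times bounded_cball)
       (simp add: linear_conv_bounded_linear)
  then have "finite {z \<in> ?S. integer_vector z}"
    by (rule finite_integer_vectors_bounded)
  moreover have "z \<in> ?S" if "height z \<le> h" "zeta \<Theta> z \<le> k" for z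
  proof (rule image_eqI)
    show "z = g (fst z, \<Theta> *v fst z - snd z)"
      by (simp add: g_def)
    have "norm (fst z) \<le> sqrt DIM(real^'n) * h"
      using that(1) by (intro order_trans[OF norm_le_infnorm] mult_left_mono) (auto simp: height_def)
    moreover have "norm (\<Theta> *v fst z - snd z) \<le> sqrt DIM(real^'m) * k"
      using that(2) by (intro order_trans[OF norm_le_infnorm] mult_left_mono) (auto simp: zeta_def)
    ultimately show "(fst z, \<Theta> *v fst z - snd z) \<in>
        cball 0 (sqrt DIM(real^'n) * h) \<times> cball 0 (sqrt DIM(real^'m) * k)"
      by simp
  qed
  ultimately show ?thesis
    by (elim rev_finite_subset) auto
qed

section \<open>Existence, size and enumeration of best approximations\<close>

lemma height_pos_iff: "0 < height z \<longleftrightarrow> fst z \<noteq> 0"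
  by (simp add: height_def infnorm_pos_lt)

text \<open>It suffices to take \<open>x\<close> an integer multiple of a single standard basis
  vector: Dirichlet's simultaneous approximation then applies to one column of
  \<open>\<Theta>\<close>.\<close>

lemma ex_integer_vector_zeta_less:
  fixes \<Theta> :: "real^'n^'m"
  assumes "0 < e"
  shows "\<exists>z. integer_vector z \<and> 0 < height z \<and> zeta \<Theta> z < e"
proof -
  obtain N where N: "N > 0" "1 / real N < e"
    using assms by (metis nat_approx_posE zero_less_Suc)
  obtain h where h: "bij_betw h {0..<CARD('m)} (UNIV :: 'm set)"
    using ex_bij_betw_nat_finite[of "UNIV :: 'm set"] by auto
  fix k0 :: 'n
  obtain q p where q: "0 < q"
    and p: "\<And>i. i < CARD('m) \<Longrightarrow> \<bar>of_int q * \<Theta> $ h i $ k0 - of_int (p i)\<bar> < 1 / N"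
    using Dirichlet_approx_simult[OF N(1), of "CARD('m)" "\<lambda>i. \<Theta> $ h i $ k0"] by metis
  \<comment> \<open>\<open>u\<close> inverts the enumeration \<open>h\<close>, carrying the
    numerators \<open>p\<close> from natural number indices back to the index type of
    \<open>y\<close>.\<close>
  define u where "u = inv_into {0..<CARD('m)} h"
  have u: "u j < CARD('m)" "h (u j) = j" for j
    using h bij_betw_inv_into_right[OF h, of j] bij_betwE[OF bij_betw_inv_into[OF h], rule_format, of j]
    by (auto simp: u_def)
  define x :: "real^'n" where "x = of_int q *\<^sub>R axis k0 1"
  define y :: "real^'m" where "y = (\<chi> j. of_int (p (u j)))"
  have "integer_vector (x, y)"
    unfolding integer_vector_Pair_iff
    by (auto simp: integer_vector_def x_def y_def Basis_vec_def inner_axis)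
       (simp add: axis_def)
  moreover have "x \<noteq> 0"
    using q by (simp add: x_def axis_eq_0_iff)
  moreover have "zeta \<Theta> (x, y) < e"
  proof -
    have "(\<Theta> *v x - y) $ j = of_int q * \<Theta> $ j $ k0 - of_int (p (u j))" for j
      by (simp add: x_def y_def matrix_vector_mult_scaleR matrix_vector_mult_basis column_def)
    then have "\<bar>(\<Theta> *v x - y) $ j\<bar> < e" for j
      using p[OF u(1), of j] N(2) by (simp add: u(2))
    then show ?thesis
      by (auto simp: zeta_def infnorm_Max Basis_vec_def inner_axis)
  qed
  ultimately show ?thesis
    by (auto simp: height_pos_iff)
qed

text \<open>A vector other than z and -z that violated the strict inequality would have the same
  height and the same \<open>zeta\<close> as \<open>z\<close>. It would thus be a best approximation
  with ties itself, which goodness forbids.\<close>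

lemma good_best_approx:
  assumes "good \<Theta>" "best_approx_with_ties \<Theta> z"
  shows "best_approx \<Theta> z"
proof -
  have "zeta \<Theta> z < zeta \<Theta> z'"
    if z': "integer_vector z'" "z' \<noteq> z" "z' \<noteq> - z" "0 < height z'" "height z' \<le> height z" for z'
  proof (rule ccontr)
    assume "\<not> zeta \<Theta> z < zeta \<Theta> z'"
    then have "zeta \<Theta> z' = zeta \<Theta> z" "height z' = height z"
      using assms(2) z' unfolding best_approx_with_ties_def
      by (metis linorder_neqE_linordered_idom not_le, metis le_less)
    then have "best_approx_with_ties \<Theta> z'"
      using assms(2) z' by (simp add: best_approx_with_ties_def flip: height_pos_iff)
    then show False
      using assms z' \<open>height z' = height z\<close> unfolding good_def by metis
  qed
  then show ?thesis
    using assms(2) by (simp add: best_approx_def best_approx_with_ties_def)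
qed

text \<open>Below a small enough threshold \<open>e\<close>, \<open>zeta\<close> forces the height
  above \<open>H\<close>. The first record below \<open>e\<close> is therefore a best approximation
  of height above \<open>H\<close>.\<close>

lemma best_approx_height_unbounded:
  fixes \<Theta> :: "real^'n^'m"
  assumes "good \<Theta>" "completely_irrational (graph_subspace \<Theta>)"
  shows "\<exists>z. best_approx \<Theta> z \<and> H < height z"
proof -
  \<comment> \<open>A bound on the height alone leaves the second component free; the cutoff at 1
    makes \<open>G\<close> finite.\<close>
  define G where "G = {z. integer_vector z \<and> 0 < height z \<and> height z \<le> H \<and> zeta \<Theta> z \<le> 1}"
  have "finite G"
    unfolding G_def by (rule finite_subset[OF _ finite_integer_vectors_height_zeta[of H \<Theta> 1]]) auto
  \<comment> \<open>The inserted 1 covers an empty \<open>G\<close> and gives e \<le> 1, so that a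
    vector of positive height at most \<open>H\<close> with \<open>zeta\<close> below
    \<open>e\<close> would fall into \<open>G\<close>.\<close>
  define e where "e = Min (insert 1 (zeta \<Theta> ` G))"
  have "0 < e"
    using \<open>finite G\<close> by (auto simp: e_def G_def height_pos_iff zero_prod_def
        intro!: zeta_pos_of_integer_vector[OF assms(2)])
  have "e \<le> 1"
    using \<open>finite G\<close> by (simp add: e_def)
  have large: "H < height z" if "integer_vector z" "0 < height z" "zeta \<Theta> z < e" for z
  proof (rule ccontr)
    assume "\<not> H < height z"
    then have "z \<in> G"
      using that \<open>e \<le> 1\<close> by (simp add: G_def)
    then have "e \<le> zeta \<Theta> z"
      using \<open>finite G\<close> by (simp add: e_def)
    then show False
      using that by simp
  qed
  obtain z0 where z0: "integer_vector z0" "0 < height z0" "zeta \<Theta> z0 < e"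
    using ex_integer_vector_zeta_less[OF \<open>0 < e\<close>] by blast
  define F where
    "F = {z. integer_vector z \<and> 0 < height z \<and> height z \<le> height z0 \<and> zeta \<Theta> z < e}"
  have "finite F"
    unfolding F_def
    by (rule finite_subset[OF _ finite_integer_vectors_height_zeta[of "height z0" \<Theta> e]]) auto
  have "z0 \<in> F"
    using z0 by (simp add: F_def)
  \<comment> \<open>The least height in \<open>F\<close> is chosen first, then the least
    \<open>zeta\<close> at that height. Integer vectors of smaller positive height lie outside
    \<open>F\<close>, so their \<open>zeta\<close> is at least \<open>e\<close>, which gives the
    strict inequality.\<close>
  obtain z1 where z1: "z1 \<in> F" "\<And>z. z \<in> F \<Longrightarrow> height z1 \<le> height z"
    using ex_is_arg_min_if_finite[of F height] \<open>finite F\<close> \<open>z0 \<in> F\<close>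
    by (auto simp: is_arg_min_linorder)
  let ?F1 = "{z \<in> F. height z = height z1}"
  obtain z where z: "z \<in> ?F1" "\<And>z'. z' \<in> ?F1 \<Longrightarrow> zeta \<Theta> z \<le> zeta \<Theta> z'"
  proof -
    have "finite ?F1" "?F1 \<noteq> {}"
      using \<open>finite F\<close> z1(1) by (simp, blast)
    then show thesis
      using ex_is_arg_min_if_finite[of ?F1 "zeta \<Theta>"] that unfolding is_arg_min_linorder by blast
  qed
  have zF: "integer_vector z" "0 < height z" "zeta \<Theta> z < e" "height z = height z1"
      "height z \<le> height z0"
    using z(1) by (auto simp: F_def)
  have "zeta \<Theta> z \<le> zeta \<Theta> z'" "height z' < height z \<Longrightarrow> zeta \<Theta> z < zeta \<Theta> z'"
    if z': "integer_vector z'" "0 < height z'" "height z' \<le> height z" for z'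
  proof -
    have "z' \<in> F" if "zeta \<Theta> z' < e"
      using that z' zF by (auto simp: F_def)
    then show "zeta \<Theta> z \<le> zeta \<Theta> z'" "height z' < height z \<Longrightarrow> zeta \<Theta> z < zeta \<Theta> z'"
      using z1(2)[of z'] z(2)[of z'] z' zF by force+
  qed
  then have "best_approx_with_ties \<Theta> z"
    using zF by (auto simp: best_approx_with_ties_def simp flip: height_pos_iff)
  then show ?thesis
    using good_best_approx[OF assms(1)] large zF by blast
qed

text \<open>Every best approximation has height at least 1, so it competes with a fixed standard
  basis vector \<open>?w\<close>, whose \<open>zeta\<close> serves as \<open>K\<close>. The
  coordinate \<open>undefined\<close> is an arbitrary one.\<close>

lemma best_approx_zeta_bounded:
  fixes \<Theta> :: "real^'n^'m"
  obtains K where "\<And>z. best_approx \<Theta> z \<Longrightarrow> zeta \<Theta> z \<le> K"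
proof
  fix z assume z: "best_approx \<Theta> z"
  let ?w = "(axis undefined 1, 0) :: (real^'n) \<times> (real^'m)"
  have ax: "axis undefined 1 \<in> (Basis :: (real^'n) set)"
    by (auto simp: Basis_vec_def)
  have int: "integer_vector ?w"
    using integer_vector_Basis[OF ax] unfolding integer_vector_Pair_iff
    by (simp add: integer_vector_def)
  have "height ?w \<le> 1"
    using infnorm_le_norm[of "fst ?w"] by (simp add: height_def)
  moreover have "1 \<le> height z"
    using z infnorm_integer_vector_ge_1[of "fst z"]
    by (metis best_approx_def height_def integer_vector_Pair_iff prod.collapse)
  moreover have "0 < height ?w"
    by (simp add: height_pos_iff axis_eq_0_iff)
  \<comment> \<open>The definition exempts z and -z from the comparison; in these cases
    \<open>zeta\<close> agrees because it is even.\<close>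
  ultimately have "?w = z \<or> ?w = - z \<or> zeta \<Theta> z < zeta \<Theta> ?w"
    using z int unfolding best_approx_def by (meson order_trans)
  then show "zeta \<Theta> z \<le> zeta \<Theta> ?w"
    using zeta_uminus[of \<Theta> z] by (elim disjE) simp_all
qed

text \<open>The index of a best approximation counts the heights up to its own. One lying above both
  \<open>H\<close> and \<open>\<nu>\<^sub>0\<close> chosen heights has index at least
  \<open>\<nu>\<^sub>0\<close>.\<close>

lemma nth_best_approx_unbounded:
  fixes \<Theta> :: "real^'n^'m"
  assumes "good \<Theta>" "completely_irrational (graph_subspace \<Theta>)"
  shows "\<exists>\<nu>\<ge>\<nu>\<^sub>0. \<exists>z \<in> nth_best_approx \<Theta> \<nu>. H < height z"
proof -
  obtain K where K: "\<And>z. best_approx \<Theta> z \<Longrightarrow> zeta \<Theta> z \<le> K"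
    using best_approx_zeta_bounded[of \<Theta>] by blast
  \<comment> \<open>Finiteness makes the index a genuine count, as \<open>card\<close> of an
    infinite set is 0.\<close>
  have fin: "finite {z. best_approx \<Theta> z \<and> height z \<le> h}" for h
    by (rule finite_subset[OF _ finite_integer_vectors_height_zeta[of h \<Theta> K]])
       (use K in \<open>auto simp: best_approx_def\<close>)
  have "infinite (height ` {z. best_approx \<Theta> z})"
  proof
    assume "finite (height ` {z. best_approx \<Theta> z})"
    then obtain h where "\<And>z. best_approx \<Theta> z \<Longrightarrow> height z \<le> h"
      using bdd_above_finite[of "height ` {z. best_approx \<Theta> z}"] by (auto simp: bdd_above_def)
    then show False
      using best_approx_height_unbounded[OF assms, of h] by force
  qed
  then obtain T where T: "finite T" "card T = \<nu>\<^sub>0" "T \<subseteq> height ` {z. best_approx \<Theta> z}"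
    using infinite_arbitrarily_large by blast
  obtain z where z: "best_approx \<Theta> z" "Max (insert H T) < height z"
    using best_approx_height_unbounded[OF assms] by blast
  have "T \<subseteq> height ` {z'. best_approx \<Theta> z' \<and> height z' \<le> height z}"
    using T(1,3) z(2) by (auto dest!: subsetD)
  then have "\<nu>\<^sub>0 \<le> card (height ` {z'. best_approx \<Theta> z' \<and> height z' \<le> height z})"
    using T(2) fin[of "height z"] by (metis card_mono finite_imageI)
  moreover have "H < height z"
    using z(2) T(1) by simp
  ultimately show ?thesis
    using z(1) unfolding nth_best_approx_def by blast
qed

section \<open>Lower bound for \<open>zeta\<close> on a subspace, and the contradiction\<close>

text \<open>The error map is linear and injective on \<open>M\<close>, hence bounded below there by
  a multiple of the norm. Passing to maximum norms costs the factor \<open>?s\<close>.\<close>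

lemma zeta_ge_height_on_subspace:
  fixes \<Theta> :: "real^'n^'m"
  assumes "subspace M" "graph_subspace \<Theta> \<inter> M = {0}"
  obtains c where "0 < c" "\<And>z. z \<in> M \<Longrightarrow> c * height z \<le> zeta \<Theta> z"
proof -
  let ?f = "\<lambda>z. \<Theta> *v fst z - snd z"
  have "linear ?f"
    by (intro linearI) (auto simp: matrix_vector_right_distrib matrix_vector_mult_scaleR
        scaleR_diff_right)
  moreover have "z = 0" if "z \<in> M" "?f z = 0" for z
    using assms(2) that by (auto simp: graph_subspace_def)
  ultimately obtain e where e: "0 < e" "\<And>z. z \<in> M \<Longrightarrow> e * norm z \<le> norm (?f z)"
    using injective_imp_isometric[OF closed_subspace[OF assms(1)] assms(1), of ?f]
    unfolding linear_conv_bounded_linear by meson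
  let ?s = "sqrt DIM(real^'m)"
  have s: "0 < ?s"
    by simp
  show thesis
  proof
    show "0 < e / ?s"
      using e(1) s by simp
    fix z assume "z \<in> M"
    have "height z \<le> norm z"
      unfolding height_def using infnorm_le_norm[of "fst z"] norm_fst_le[of "fst z" "snd z"] by simp
    then have "e * height z \<le> e * norm z"
      using e(1) by simp
    also have "\<dots> \<le> ?s * zeta \<Theta> z"
      using e(2)[OF \<open>z \<in> M\<close>] norm_le_infnorm[of "?f z"] by (simp add: zeta_def)
    finally show "e / ?s * height z \<le> zeta \<Theta> z"
      using s by (simp add: field_simps)
  qed
qed

theorem theorem3p6:
  fixes \<Theta> :: "real^'n^'m" and d :: nat
  assumes "d = CARD('n) + CARD('m)"
    and "good \<Theta>"
    and "completely_irrational (graph_subspace \<Theta>)"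
  shows "R \<Theta> \<ge> d - CARD('n) + 1"
proof (rule ccontr)
  assume "\<not> R \<Theta> \<ge> d - CARD('n) + 1"
  then have small: "R \<Theta> \<le> CARD('m)"
    using assms(1) by simp
  \<comment> \<open>The whole space is a candidate, so the \<open>LEAST\<close> in \<open>R\<close>
    is attained.\<close>
  have "\<exists>r. \<exists>B :: ((real^'n) \<times> (real^'m)) set. \<exists>\<nu>\<^sub>0.
      subspace B \<and> dim B = r \<and> (\<forall>\<nu>\<ge>\<nu>\<^sub>0. nth_best_approx \<Theta> \<nu> \<subseteq> B)"
    using subspace_UNIV by blast
  from LeastI_ex[OF this, folded R_def]
  obtain B :: "((real^'n) \<times> (real^'m)) set" and \<nu>\<^sub>0
    where B: "dim B = R \<Theta>" "\<And>\<nu>. \<nu> \<ge> \<nu>\<^sub>0 \<Longrightarrow> nth_best_approx \<Theta> \<nu> \<subseteq> B"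
    by blast
  \<comment> \<open>\<open>B\<close> itself need not be rational, so it is replaced by the integer
    vectors in it that matter, whose span has no larger dimension.\<close>
  define W where "W = (\<Union>\<nu>\<in>{\<nu>\<^sub>0..}. nth_best_approx \<Theta> \<nu>)"
  have "dim W \<le> CARD('m)"
    using dim_subset[of W B] B small by (force simp: W_def)
  moreover have "integer_vector w" if "w \<in> W" for w
    using that by (auto simp: W_def nth_best_approx_def best_approx_def)
  ultimately obtain M where M: "rational_subspace M" "dim M = CARD('m)" "W \<subseteq> M"
    using rational_subspace_extend[of W "CARD('m)"] by auto
  have "subspace M"
    using M(1) by (auto simp: rational_subspace_def)
  then obtain c where c: "0 < c" "\<And>z. z \<in> M \<Longrightarrow> c * height z \<le> zeta \<Theta> z"
    using completely_irrational_graph_Int[OF assms(3) M(1,2)]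
    by (rule zeta_ge_height_on_subspace) blast
  obtain K where K: "\<And>z. best_approx \<Theta> z \<Longrightarrow> zeta \<Theta> z \<le> K"
    using best_approx_zeta_bounded[of \<Theta>] by blast
  obtain \<nu> z where z: "\<nu> \<ge> \<nu>\<^sub>0" "z \<in> nth_best_approx \<Theta> \<nu>" "K / c < height z"
    using nth_best_approx_unbounded[OF assms(2,3)] by blast
  then have "best_approx \<Theta> z" "z \<in> M"
    using M(3) by (auto simp: nth_best_approx_def W_def)
  then have "c * height z \<le> K"
    using c(2) K by (meson order_trans)
  then show False
    using z(3) c(1) by (simp add: field_simps)
qed

end
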